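(* Let $P_{(2,0,0,0)}$ be the set of all cylindric partitions with profile $c=(2,0,0,0)$. Then, as formal power series in $q$, $$\sum_{\Lambda\in P_{(2,0,0,0)}} q^{|\Lambda|}=\left(\sum_{n\ge0}\frac{q^{n(n+1)}(-q^2;q^2)_n}{(-q^3;q^2)_n\,(q^2;q^2)_n}\right)\frac{(-q^3;q^2)_\infty}{(q;q)_\infty}.$$
   Context: Let $r,\ell$ be positive integers and $c=(c_1,\dots,c_r)$ a composition of $\ell$ into $r$ nonnegative integer parts (zero entries allowed). A cylindric partition with profile $c$ is a tuple $\Lambda=(\lambda^{(1)},\dots,\lambda^{(r)})$ of ordinary partitions $\lambda^{(i)}=(\lambda^{(i)}_1\ge\lambda^{(i)}_2\ge\cdots)$ (parts beyond the length are taken to be $0$) such that for all $i,j$: $\lambda^{(i)}_j\ge\lambda^{(i+1)}_{j+c_{i+1}}$ for $1\le i\le r-1$, and $\lambda^{(r)}_j\ge\lambda^{(1)}_{j+c_1}$. The size $|\Lambda|$ is the sum of all parts of all $\lambda^{(i)}$; the empty cylindric partition is included with size $0$. Notation: $(a;q)_n=\prod_{k=1}^n(1-aq^{k-1})$, $(a;q)_\infty=\lim_{n\to\infty}(a;q)_n$. *)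

theory Defs
  imports "HOL-Analysis.Analysis" "HOL-Computational_Algebra.Formal_Power_Series"
begin

text \<open>A partition is the list of its positive parts in weakly decreasing order, so that every
  partition has exactly one representation.\<close>

definition is_partition :: "nat list \<Rightarrow> bool" where
  "is_partition p \<longleftrightarrow> sorted_wrt (\<ge>) p \<and> (\<forall>x\<in>set p. 0 < x)"

text \<open>Parts are numbered from 0 here, and so are the components of a profile and of a tuple of
  partitions below; parts beyond the length are 0.\<close>

definition part :: "nat list \<Rightarrow> nat \<Rightarrow> nat" where
  "part p j = (if j < length p then p ! j else 0)"

text \<open>A profile is a nonempty list \<open>c\<close> of nonnegative integers; its length is the rank \<open>r\<close> and
  its sum is the level, which is required to be positive.\<close>

definition is_profile :: "nat list \<Rightarrow> bool" where
  "is_profile c \<longleftrightarrow> c \<noteq> [] \<and> 0 < sum_list c"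

definition cylindric_partitions :: "nat list \<Rightarrow> nat list list set" where
  "cylindric_partitions c = {L. is_profile c \<and> length L = length c \<and>
     (\<forall>p\<in>set L. is_partition p) \<and>
     (\<forall>i j. i + 1 < length c \<longrightarrow> part (L ! i) j \<ge> part (L ! (i + 1)) (j + c ! (i + 1))) \<and>
     (\<forall>j. part (L ! (length c - 1)) j \<ge> part (L ! 0) (j + c ! 0))}"

definition cp_size :: "nat list list \<Rightarrow> nat" where
  "cp_size L = (\<Sum>p\<leftarrow>L. sum_list p)"

definition qpoch :: "'a::comm_ring_1 \<Rightarrow> 'a \<Rightarrow> nat \<Rightarrow> 'a" where
  "qpoch a q n = (\<Prod>k=1..n. 1 - a * q ^ (k - 1))"

text \<open>For formal power series the limit is taken in the library's metric, which induces the
  topology of coefficientwise eventual constancy.\<close>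

definition qpoch_inf :: "'a::{comm_ring_1,t2_space} \<Rightarrow> 'a \<Rightarrow> 'a" where
  "qpoch_inf a q = lim (\<lambda>n. qpoch a q n)"

end

theory Submission
  imports Defs
begin

text \<open>A cylindric partition of profile \<open>(2,0,0,0)\<close> is a pair of partitions \<open>a\<close>, \<open>b\<close> with
  \<open>a\<^sub>k \<ge> b\<^sub>k \<ge> a\<^bsub>k+4\<^esub>\<close>. Let \<open>H(x,y)\<close> be the generating function of the pairs with at most \<open>x\<close> and \<open>y\<close>
  parts. Subtracting \<open>1\<close> from all entries gives, for \<open>y \<le> x \<le> y + 4\<close>,
  \<open>(1 - q\<^bsup>x+y\<^esup>) H(x,y) = H(x-1,y) + H(x,y-1) - H(x-1,y-1)\<close>. After multiplication by \<open>(q;q)\<^bsub>x+y\<^esub>\<close> this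
  becomes a polynomial recurrence along the diagonals \<open>x - y = 1, 2, 3\<close>. The tails of the series on
  the right-hand side of the theorem satisfy the adjoint recurrence and tend to \<open>1\<close>, so the
  pairing of the two solutions is a constant that equals both the limit of
  \<open>(q;q)\<^bsub>x+y\<^esub> H(x,y)\<close> and the series itself.\<close>

subsection \<open>The series side\<close>

lemma fps_X_power_dvd_iff:
  fixes f :: "'a::comm_ring_1 fps"
  shows "fps_X ^ K dvd f \<longleftrightarrow> (\<forall>i<K. fps_nth f i = 0)"
proof
  assume "fps_X ^ K dvd f"
  then show "\<forall>i<K. fps_nth f i = 0"
    by (auto simp: dvd_def fps_X_power_mult_nth)
next
  assume *: "\<forall>i<K. fps_nth f i = 0"
  have "f = fps_X ^ K * fps_shift K f"
    by (rule fps_ext) (use * in \<open>auto simp: fps_X_power_mult_nth\<close>)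
  then show "fps_X ^ K dvd f" by (metis dvd_triv_left)
qed

text \<open>Turns an identity between limits into congruences: both sides are compared modulo every
  power of \<open>fps_X\<close>, where finite truncations suffice.\<close>

lemma fps_eq_if_diff_dvd:
  fixes f g :: "'a::comm_ring_1 fps"
  assumes "\<And>K. fps_X ^ K dvd f - g"
  shows "f = g"
proof (rule fps_ext)
  fix n show "fps_nth f n = fps_nth g n"
    using assms[of "Suc n", unfolded fps_X_power_dvd_iff] by simp
qed

text \<open>Coefficient \<open>i\<close> of \<open>u n\<close> no longer changes once
  \<open>n > i\<close>. So the limit exists, and \<open>u n\<close> already has its final
  coefficients below \<open>n\<close>.\<close>

lemma fps_Cauchy_dvd_lim:
  fixes u :: "nat \<Rightarrow> 'a::comm_ring_1 fps"
  assumes "\<And>n. fps_X ^ n dvd u (Suc n) - u n"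
  shows "fps_X ^ n dvd lim u - u n"
proof -
  have stable: "fps_nth (u (n + k)) i = fps_nth (u n) i" if "i < n" for n k i
    by (induction k) (use that assms[of "n + k" for k] in \<open>auto simp: fps_X_power_dvd_iff\<close>)
  define L where "L = Abs_fps (\<lambda>i. fps_nth (u (Suc i)) i)"
  have L: "fps_nth (u n) i = fps_nth L i" if "i < n" for n i
    using stable[of i "Suc i" "n - Suc i"] that by (simp add: L_def)
  have "u \<longlonglongrightarrow> L"
  proof (rule tendsto_fpsI)
    fix i show "\<forall>\<^sub>F n in sequentially. fps_nth (u n) i = fps_nth L i"
      using eventually_gt_at_top[of i] by eventually_elim (rule L)
  qed
  then have "lim u = L" by (rule limI)
  then show ?thesis by (simp add: fps_X_power_dvd_iff L)
qed

lemma fps_suminf_dvd: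
  fixes u :: "nat \<Rightarrow> 'a::comm_ring_1 fps"
  assumes "\<And>n. fps_X ^ n dvd u n"
  shows "fps_X ^ n dvd suminf u - (\<Sum>k<n. u k)"
  unfolding suminf_eq_lim by (rule fps_Cauchy_dvd_lim) (simp add: assms)

section \<open>Finite and infinite q-Pochhammer products\<close>

lemma qpoch_0 [simp]: "qpoch a q 0 = 1"
  by (simp add: qpoch_def)

lemma qpoch_Suc: "qpoch a q (Suc n) = qpoch a q n * (1 - a * q ^ n)"
  by (simp add: qpoch_def)

lemma qpoch_add: "qpoch a q (m + n) = qpoch a q m * qpoch (a * q ^ m) q n"
  by (induction n) (simp_all add: qpoch_Suc power_add mult_ac)

lemma fps_X_power_dvd_power:
  fixes q :: "'a::comm_ring_1 fps"
  assumes "fps_X dvd q"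
  shows "fps_X ^ n dvd q ^ n"
  using assms by (rule dvd_power_same)

lemma qpoch_inf_dvd:
  fixes q :: "'a::comm_ring_1 fps"
  assumes "fps_X dvd q"
  shows "fps_X ^ n dvd qpoch_inf a q - qpoch a q n"
  unfolding qpoch_inf_def
  by (rule fps_Cauchy_dvd_lim)
    (simp add: qpoch_Suc algebra_simps dvd_mult fps_X_power_dvd_power[OF assms])

lemma dvd_diff_trans:
  fixes a b c :: "'a::comm_ring_1"
  assumes "k dvd a - b" "k dvd b - c"
  shows "k dvd a - c"
  using dvd_add[OF assms] by simp

lemma dvd_mult_diff:
  fixes a b c d :: "'a::comm_ring_1"
  assumes "k dvd a - b" "k dvd c - d"
  shows "k dvd a * c - b * d"
proof -
  have "a * c - b * d = (a - b) * c + b * (c - d)" by (simp add: algebra_simps)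
  then show ?thesis using assms by simp
qed

text \<open>Modulo \<open>fps_X ^ K\<close> both sides agree with the finite product of length
  \<open>m + K\<close>.\<close>

lemma qpoch_inf_split:
  fixes q :: "'a::comm_ring_1 fps"
  assumes "fps_X dvd q"
  shows "qpoch_inf a q = qpoch a q m * qpoch_inf (a * q ^ m) q"
proof (rule fps_eq_if_diff_dvd)
  fix K
  have "fps_X ^ K dvd qpoch_inf a q - qpoch a q (m + K)"
    by (rule dvd_trans[OF _ qpoch_inf_dvd[OF assms]]) (simp add: le_imp_power_dvd)
  moreover have "fps_X ^ K dvd qpoch a q (m + K) - qpoch a q m * qpoch_inf (a * q ^ m) q"
    using dvd_mult[OF qpoch_inf_dvd[OF assms, of K "a * q ^ m"], of "qpoch a q m"]
    unfolding qpoch_add right_diff_distrib by (subst dvd_minus_iff[symmetric]) simp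
  ultimately show "fps_X ^ K dvd qpoch_inf a q - qpoch a q m * qpoch_inf (a * q ^ m) q"
    by (rule dvd_diff_trans)
qed

lemma qpoch_minus_1_dvd: "a dvd qpoch a q n - 1"
proof (induction n)
  case (Suc n)
  have "qpoch a q (Suc n) - 1 = (qpoch a q n - 1) - a * (q ^ n * qpoch a q n)"
    by (simp add: qpoch_Suc algebra_simps)
  then show ?case using Suc by (metis dvd_diff dvd_triv_left)
qed simp

lemma qpoch_inf_minus_1_dvd:
  fixes q :: "'a::comm_ring_1 fps"
  assumes "fps_X dvd q" "fps_X ^ k dvd a"
  shows "fps_X ^ k dvd qpoch_inf a q - 1"
  by (rule dvd_diff_trans[OF qpoch_inf_dvd[OF assms(1)] dvd_trans[OF assms(2) qpoch_minus_1_dvd]])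

lemma qpoch_nth_0:
  fixes q :: "'a::comm_ring_1 fps"
  assumes "fps_nth a 0 = 0"
  shows "fps_nth (qpoch a q n) 0 = 1"
  by (induction n) (simp_all add: qpoch_Suc assms)

lemma qpoch_inf_nth_0:
  fixes q :: "'a::comm_ring_1 fps"
  assumes "fps_X dvd q" "fps_nth a 0 = 0"
  shows "fps_nth (qpoch_inf a q) 0 = 1"
  using qpoch_inf_minus_1_dvd[OF assms(1), of 1 a] fps_X_power_dvd_iff[of 1 a]
    fps_X_power_dvd_iff[of 1 "qpoch_inf a q - 1"] assms(2) by simp

section \<open>The tails of the series and their q-difference equation\<close>

definition tail_prod :: "nat \<Rightarrow> rat fps" where
  "tail_prod m = qpoch_inf (- (fps_X ^ (2 * m + 1))) (fps_X ^ 2)"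

definition qratio :: "nat \<Rightarrow> rat fps" where
  "qratio n = qpoch (- (fps_X ^ 2)) (fps_X ^ 2) n / qpoch (fps_X ^ 2) (fps_X ^ 2) n"

text \<open>For \<open>m = 0\<close> this is the summand of the theorem times (-q^3;q^2)_inf: the
  product cancels the denominator (-q^3;q^2)_n and leaves \<open>tail_prod (n + 1)\<close>.\<close>

definition qterm :: "nat \<Rightarrow> nat \<Rightarrow> rat fps" where
  "qterm m n = fps_X ^ (n * (n + 1) + 2 * m * n) * qratio n * tail_prod (m + n + 1)"

definition qseries :: "nat \<Rightarrow> rat fps" where
  "qseries m = (\<Sum>n. qterm m n)"

lemma fps_X_dvd_square: "(fps_X :: 'a::comm_ring_1 fps) dvd fps_X ^ 2"
  by (simp add: power2_eq_square)

lemma tail_prod_rec: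
  "tail_prod m = (1 + fps_X ^ (2 * m + 1)) * tail_prod (Suc m)"
  unfolding tail_prod_def
  by (subst qpoch_inf_split[OF fps_X_dvd_square, where m = 1])
    (simp add: qpoch_def power_add power2_eq_square mult_ac)

lemma qratio_Suc:
  "(1 - fps_X ^ (2 * n + 2)) * qratio (Suc n) = (1 + fps_X ^ (2 * n + 2)) * qratio n"
proof -
  let ?a = "qpoch (- (fps_X ^ 2)) (fps_X ^ 2) :: nat \<Rightarrow> rat fps"
  let ?b = "qpoch (fps_X ^ 2) (fps_X ^ 2) :: nat \<Rightarrow> rat fps"
  have b: "fps_nth (?b n) 0 = 1" for n by (rule qpoch_nth_0) simp
  then have mult: "?b n * qratio n = ?a n" for n
    by (simp add: qratio_def fps_divide_unit inverse_mult_eq_1' mult.left_commute)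
  have b0: "?b n \<noteq> 0" using b[of n] by (metis fps_zero_nth zero_neq_one)
  obtain c where c: "c = (fps_X ^ (2 * n + 2) :: rat fps)" by blast
  have exp: "fps_X ^ 2 * (fps_X ^ 2) ^ n = c"
    unfolding c power_add power_mult by (rule mult.commute)
  have "?b n * ((1 - c) * qratio (Suc n)) = ?b (Suc n) * qratio (Suc n)"
    unfolding qpoch_Suc exp by (simp only: mult_ac)
  also have "\<dots> = ?a n * (1 + c)"
    unfolding mult unfolding qpoch_Suc mult_minus_left exp by simp
  also have "\<dots> = ?b n * ((1 + c) * qratio n)"
    unfolding mult[symmetric] by (simp only: mult_ac)
  finally show ?thesis using b0 unfolding c by (metis mult_cancel_left)
qed

lemma qterm_dvd: "fps_X ^ (n * (n + 1) + 2 * m * n) dvd qterm m n"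
  by (simp add: qterm_def mult.assoc)

lemma qterm_dvd': "fps_X ^ n dvd qterm m n"
  by (rule dvd_trans[OF _ qterm_dvd]) (rule le_imp_power_dvd, simp)

lemma qseries_dvd: "fps_X ^ N dvd qseries m - (\<Sum>n<N. qterm m n)"
  unfolding qseries_def by (rule fps_suminf_dvd) (rule qterm_dvd')

text \<open>With \<open>t = q\<^bsup>2m+2\<^esup>\<close>, the series \<open>qseries m\<close> is \<open>A(t)\<close> for
  \<open>A(t) = (\<Sum>n. q\<^bsup>n(n-1)\<^esup> t\<^bsup>n\<^esup> (-q\<^sup>2;q\<^sup>2)\<^sub>n / (q\<^sup>2;q\<^sup>2)\<^sub>n (-t q\<^bsup>2n+1\<^esup>;q\<^sup>2)\<^sub>\<infinity>)\<close>; here \<open>G\<close> is a telescoping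
  certificate for the second order \<open>q\<^sup>2\<close>-difference equation of \<open>A\<close>.\<close>

lemma qterm_telescope:
  defines "G \<equiv> \<lambda>m n. fps_X ^ (n * (n + 1) + 2 * m * n) * qratio n * tail_prod (m + n + 3)
    * (1 - fps_X ^ (2 * n)) * (1 + fps_X ^ (2 * m + 2 * n + 5))"
  shows "qterm m n - (1 + fps_X ^ (2 * m + 2) * (1 + fps_X)) * qterm (m + 1) n
      - fps_X ^ (2 * m + 4) * (1 - fps_X ^ (2 * m + 3)) * qterm (m + 2) n
    = G m n - G m (Suc n)"
proof -
  obtain x where x: "fps_X = (x :: rat fps)" by blast
  define t where "t = x ^ (2 * m)"
  define N where "N = x ^ (2 * n)"
  \<comment> \<open>The common factor of all five terms, with the tail that occurs in
    \<open>qterm (m + 2) n\<close>. The identity then becomes polynomial in \<open>s\<close>,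
    \<open>t\<close>, \<open>N\<close> and \<open>x\<close>.\<close>
  define s where "s = x ^ (n * (n + 1) + 2 * m * n) * qratio n * tail_prod (m + n + 3)"
  note tail = tail_prod_rec[unfolded x] and qterm = qterm_def[unfolded x] and qratio = qratio_Suc[unfolded x]
  have P1: "tail_prod (m + n + 1) = (1 + t * N * x ^ 3) * tail_prod (m + n + 2)"
    using tail[of "m + n + 1"] by (simp add: t_def N_def power_add eval_nat_numeral mult_ac)
  have P2: "tail_prod (m + n + 2) = (1 + t * N * x ^ 5) * tail_prod (m + n + 3)"
    using tail[of "m + n + 2"] by (simp add: t_def N_def power_add eval_nat_numeral mult_ac)
  have P3: "tail_prod (m + n + 3) = (1 + t * N * x ^ 7) * tail_prod (m + n + 4)"
    using tail[of "m + n + 3"] by (simp add: t_def N_def power_add eval_nat_numeral mult_ac)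
  have exps: "n * (n + 1) + 2 * (m + 1) * n = (n * (n + 1) + 2 * m * n) + 2 * n"
    "n * (n + 1) + 2 * (m + 2) * n = (n * (n + 1) + 2 * m * n) + 2 * n + 2 * n"
    "Suc n * (Suc n + 1) + 2 * m * Suc n = (n * (n + 1) + 2 * m * n) + 2 * m + 2 * n + 2"
    "m + 1 + n + 1 = m + n + 2" "m + 2 + n + 1 = m + n + 3" "m + Suc n + 3 = m + n + 4"
    by (simp_all add: algebra_simps)
  have pows: "x ^ (2 * Suc n) = N * x ^ 2" "x ^ (2 * m + 2 * Suc n + 5) = t * N * x ^ 7"
    "x ^ (2 * n + 2) = N * x ^ 2" "x ^ (2 * m + 2 * n + 5) = t * N * x ^ 5"
    "x ^ (2 * m + 2) = t * x ^ 2" "x ^ (2 * m + 4) = t * x ^ 4" "x ^ (2 * m + 3) = t * x ^ 3"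
    by (simp_all add: N_def t_def power_add eval_nat_numeral mult_ac)
  have e1: "qterm m n = s * (1 + t * N * x ^ 3) * (1 + t * N * x ^ 5)"
    unfolding qterm P1 P2 s_def by (simp only: mult_ac)
  have e2: "qterm (m + 1) n = s * N * (1 + t * N * x ^ 5)"
    unfolding qterm exps P2 power_add s_def N_def by (simp only: mult_ac)
  have e3: "qterm (m + 2) n = s * N ^ 2"
    unfolding qterm exps power_add s_def N_def power2_eq_square by (simp only: mult_ac)
  have g1: "G m n = s * (1 - N) * (1 + t * N * x ^ 5)"
    unfolding G_def x pows s_def N_def[symmetric] by (simp only: mult_ac)
  \<comment> \<open>The factor \<open>1 - N * x ^ 2\<close> reduces \<open>qratio (Suc n)\<close> to
    \<open>qratio n\<close>, and the last factor of \<open>G\<close> completes the tail from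
    \<open>m + n + 4\<close> to \<open>m + n + 3\<close>.\<close>
  have "G m (Suc n) = x ^ (n * (n + 1) + 2 * m * n) * t * N * x ^ 2
      * ((1 - N * x ^ 2) * qratio (Suc n)) * ((1 + t * N * x ^ 7) * tail_prod (m + n + 4))"
    unfolding G_def x exps pows unfolding power_add t_def N_def by (simp only: mult_ac)
  also have "\<dots> = s * t * N * x ^ 2 * (1 + N * x ^ 2)"
    unfolding P3[symmetric] qratio[of n, unfolded pows] s_def by (simp only: mult_ac)
  finally have g2: "G m (Suc n) = s * t * N * x ^ 2 * (1 + N * x ^ 2)" .
  show ?thesis
    unfolding x e1 e2 e3 g1 g2 pows by algebra
qed

text \<open>Sum the telescoping identity over \<open>n < K\<close>: \<open>G 0\<close> vanishes by
  its factor \<open>1 - fps_X ^ (2 * n)\<close>, and \<open>G K\<close> is divisible by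
  \<open>fps_X ^ K\<close>.\<close>

lemma qseries_rec:
  "qseries m = (1 + fps_X ^ (2 * m + 2) * (1 + fps_X)) * qseries (m + 1)
      + fps_X ^ (2 * m + 4) * (1 - fps_X ^ (2 * m + 3)) * qseries (m + 2)"
proof (rule fps_eq_if_diff_dvd)
  fix K
  define c1 :: "rat fps" where "c1 = 1 + fps_X ^ (2 * m + 2) * (1 + fps_X)"
  define c2 :: "rat fps" where "c2 = fps_X ^ (2 * m + 4) * (1 - fps_X ^ (2 * m + 3))"
  define S where "S j = (\<Sum>n<K. qterm (m + j) n)" for j
  define G where "G n = fps_X ^ (n * (n + 1) + 2 * m * n) * qratio n * tail_prod (m + n + 3)
    * (1 - fps_X ^ (2 * n)) * (1 + fps_X ^ (2 * m + 2 * n + 5))" for n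
  have "S 0 - c1 * S 1 - c2 * S 2 = (\<Sum>n<K. G n - G (Suc n))"
    unfolding S_def sum_distrib_left sum_subtractf[symmetric] G_def c1_def c2_def add_0_right
    by (intro sum.cong refl qterm_telescope)
  also have "\<dots> = - G K"
    by (subst sum_lessThan_telescope') (simp add: G_def)
  finally have S: "S 0 - c1 * S 1 - c2 * S 2 = - G K" .
  have "fps_X ^ K dvd fps_X ^ (K * (K + 1) + 2 * m * K) * (qratio K * tail_prod (m + K + 3)
    * (1 - fps_X ^ (2 * K)) * (1 + fps_X ^ (2 * m + 2 * K + 5)))"
    by (rule dvd_mult2, rule le_imp_power_dvd, simp)
  then have G: "fps_X ^ K dvd G K" by (simp only: G_def mult.assoc)
  have D: "fps_X ^ K dvd qseries (m + j) - S j" for j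
    unfolding S_def by (rule qseries_dvd)
  have "qseries m - (c1 * qseries (m + 1) + c2 * qseries (m + 2))
     = (qseries (m + 0) - S 0) - c1 * (qseries (m + 1) - S 1) - c2 * (qseries (m + 2) - S 2) - G K"
    using S by (simp add: algebra_simps)
  also have "fps_X ^ K dvd \<dots>"
    by (intro dvd_diff dvd_mult D G)
  finally show "fps_X ^ K dvd qseries m - (c1 * qseries (m + 1) + c2 * qseries (m + 2))" .
qed

text \<open>Modulo \<open>fps_X ^ (2 * m)\<close> only the term \<open>n = 0\<close> survives; it is
  \<open>tail_prod (m + 1)\<close>, all of whose factors are congruent to 1.\<close>

lemma qseries_minus_1_dvd: "fps_X ^ (2 * m) dvd qseries m - 1"
proof -
  have "fps_X ^ (2 * m) dvd (\<Sum>n<Suc (2 * m). qterm m n) - 1"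
  proof -
    have "fps_X ^ (2 * m) dvd qterm m (Suc n)" for n
      by (rule dvd_trans[OF _ qterm_dvd]) (rule le_imp_power_dvd, simp)
    then have "fps_X ^ (2 * m) dvd (\<Sum>n<2 * m. qterm m (Suc n))" by (intro dvd_sum) simp
    moreover have "fps_X ^ (2 * m) dvd qterm m 0 - 1"
    proof -
      have "fps_X ^ (2 * m) dvd tail_prod (m + 1) - 1"
        unfolding tail_prod_def
        by (rule qpoch_inf_minus_1_dvd[OF fps_X_dvd_square])
          (simp only: dvd_minus_iff, rule le_imp_power_dvd, simp)
      then show ?thesis by (simp add: qterm_def qratio_def)
    qed
    moreover have "(\<Sum>n<Suc (2 * m). qterm m n) - 1
        = (qterm m 0 - 1) + (\<Sum>n<2 * m. qterm m (Suc n))"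
      by (subst sum.lessThan_Suc_shift) simp
    ultimately show ?thesis by (metis dvd_add)
  qed
  moreover have "fps_X ^ (2 * m) dvd qseries m - (\<Sum>n<Suc (2 * m). qterm m n)"
    by (rule dvd_trans[OF _ qseries_dvd]) (rule le_imp_power_dvd, simp)
  ultimately show ?thesis using dvd_diff_trans by blast
qed

text \<open>The infinite product is distributed over the partial sums, where it turns each summand
  into \<open>qterm 0 n\<close>.\<close>

lemma qseries_0:
  fixes q :: "rat fps"
  defines "q \<equiv> fps_X"
  shows "(\<Sum>n. q ^ (n * (n + 1)) * qpoch (- (q ^ 2)) (q ^ 2) n /
                   (qpoch (- (q ^ 3)) (q ^ 2) n * qpoch (q ^ 2) (q ^ 2) n))
             * qpoch_inf (- (q ^ 3)) (q ^ 2) = qseries 0"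
proof (rule fps_eq_if_diff_dvd)
  fix K
  let ?a = "\<lambda>n. qpoch (- (q ^ 3)) (q ^ 2) n"
  let ?b = "\<lambda>n. qpoch (q ^ 2) (q ^ 2) n"
  let ?P = "qpoch_inf (- (q ^ 3)) (q ^ 2)"
  define u where "u n = q ^ (n * (n + 1)) * qpoch (- (q ^ 2)) (q ^ 2) n / (?a n * ?b n)" for n
  have a: "fps_nth (?a n) 0 = 1" and b: "fps_nth (?b n) 0 = 1" for n
    by (simp_all add: qpoch_nth_0 q_def)
  have u: "u n = q ^ (n * (n + 1)) * qratio n * inverse (?a n)" for n
    using a[of n] b[of n]
    by (simp add: u_def qratio_def fps_divide_unit fps_inverse_mult mult_ac q_def)
  have "u n * ?P = qterm 0 n" for n
  proof -
    have P: "?P = ?a n * tail_prod (n + 1)"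
      unfolding tail_prod_def q_def
      by (subst qpoch_inf_split[OF fps_X_dvd_square, where m = n])
        (simp add: power_add eval_nat_numeral mult_ac power_mult_distrib)
    have "inverse (?a n) * ?a n = 1" using a[of n] by (simp add: inverse_mult_eq_1)
    then have "u n * ?P = q ^ (n * (n + 1)) * qratio n * tail_prod (n + 1)"
      unfolding u P by (metis (no_types, lifting) mult.assoc mult.left_neutral)
    then show ?thesis by (simp add: qterm_def q_def)
  qed
  then have sums: "(\<Sum>n<K. qterm 0 n) = (\<Sum>n<K. u n) * ?P"
    by (simp add: sum_distrib_right)
  have "fps_X ^ n dvd u n" for n
    unfolding u mult.assoc q_def by (rule dvd_mult2, rule le_imp_power_dvd, simp)
  then have "fps_X ^ K dvd suminf u - (\<Sum>n<K. u n)" by (rule fps_suminf_dvd)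
  then have "fps_X ^ K dvd suminf u * ?P - (\<Sum>n<K. u n) * ?P"
    by (rule dvd_mult_diff) simp
  moreover have "fps_X ^ K dvd (\<Sum>n<K. u n) * ?P - qseries 0"
    using qseries_dvd[of K 0] unfolding sums by (simp add: dvd_diff_commute)
  ultimately show "fps_X ^ K dvd suminf u * ?P - qseries 0"
    by (rule dvd_diff_trans)
qed

subsection \<open>Counting interlaced pairs\<close>

text \<open>A true count only if the fibres of \<open>w\<close> are finite, since
  \<open>card\<close> of an infinite set is 0; hence the finiteness lemmas below.\<close>

definition genfun :: "('a \<Rightarrow> nat) \<Rightarrow> 'a set \<Rightarrow> rat fps" where
  "genfun w A = Abs_fps (\<lambda>n. of_nat (card {p \<in> A. w p = n}))"

lemma genfun_has_sum:
  assumes "\<And>n. finite {p \<in> A. w p = n}"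
  shows "((\<lambda>p. fps_X ^ w p) has_sum genfun w A) A"
proof (rule has_sum_fpsI)
  fix n
  have *: "{p \<in> A. fps_nth (fps_X ^ w p :: rat fps) n \<noteq> 0} = {p \<in> A. w p = n}"
    by (auto simp: fps_X_power_iff)
  show "finite {p \<in> A. fps_nth (fps_X ^ w p :: rat fps) n \<noteq> 0}"
    unfolding * by (rule assms)
  show "fps_nth (genfun w A) n = (\<Sum>p | p \<in> A \<and> fps_nth (fps_X ^ w p :: rat fps) n \<noteq> 0. fps_nth (fps_X ^ w p) n)"
    unfolding * by (simp add: genfun_def fps_X_power_iff)
qed

lemma genfun_Un_Int:
  assumes "\<And>n. finite {p \<in> A. w p = n}" "\<And>n. finite {p \<in> B. w p = n}"
  shows "genfun w (A \<union> B) + genfun w (A \<inter> B) = genfun w A + genfun w B"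
proof (rule fps_ext)
  fix n
  have "{p \<in> A \<union> B. w p = n} = {p \<in> A. w p = n} \<union> {p \<in> B. w p = n}"
    "{p \<in> A \<inter> B. w p = n} = {p \<in> A. w p = n} \<inter> {p \<in> B. w p = n}" by auto
  then have "card {p \<in> A \<union> B. w p = n} + card {p \<in> A \<inter> B. w p = n}
     = card {p \<in> A. w p = n} + card {p \<in> B. w p = n}"
    using card_Un_Int[OF assms(1)[of n] assms(2)[of n]] by simp
  then show "fps_nth (genfun w (A \<union> B) + genfun w (A \<inter> B)) n = fps_nth (genfun w A + genfun w B) n"
    unfolding genfun_def fps_add_nth fps_nth_Abs_fps of_nat_add[symmetric] by simp
qed

lemma genfun_image_shift:
  assumes "inj_on f A" "\<And>p. p \<in> A \<Longrightarrow> w (f p) = w p + k"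
  shows "genfun w (f ` A) = fps_X ^ k * genfun w A"
proof (rule fps_ext)
  fix n
  have "card {p \<in> f ` A. w p = n} = (if n < k then 0 else card {p \<in> A. w p = n - k})"
  proof (cases "n < k")
    case True
    then have "{p \<in> f ` A. w p = n} = {}" using assms(2) by auto
    then have "card {p \<in> f ` A. w p = n} = 0" by (simp only: card.empty)
    with True show ?thesis by simp
  next
    case False
    then have "{p \<in> f ` A. w p = n} = f ` {p \<in> A. w p = n - k}" using assms(2) by auto
    with False show ?thesis
      by (simp add: card_image inj_on_subset[OF assms(1)])
  qed
  then show "fps_nth (genfun w (f ` A)) n = fps_nth (fps_X ^ k * genfun w A) n"
    by (simp add: genfun_def fps_X_power_mult_nth)
qed

lemma bij_betw_genfun:
  assumes "bij_betw f A B" "\<And>p. p \<in> A \<Longrightarrow> w' (f p) = w p"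
  shows "genfun w A = genfun w' B"
proof (rule fps_ext)
  fix n
  have "bij_betw f {p \<in> A. w p = n} {p \<in> B. w' p = n}"
    by (rule bij_betw_Collect[OF assms(1)]) (simp add: assms(2))
  then show "fps_nth (genfun w A) n = fps_nth (genfun w' B) n"
    by (simp add: genfun_def bij_betw_same_card)
qed

text \<open>Reading a cylindric partition of profile \<open>(2,0,0,0)\<close> column by column, the columns with even
  index form one weakly decreasing sequence \<open>a\<close> and those with odd index another one \<open>b\<close>.\<close>

definition interlaced :: "((nat \<Rightarrow> nat) \<times> (nat \<Rightarrow> nat)) set" where
  "interlaced = {(a, b). antimono a \<and> antimono b \<and> (\<forall>k. b k \<le> a k) \<and> (\<forall>k. a (k + 4) \<le> b k)
     \<and> (\<exists>N. \<forall>k\<ge>N. a k = 0)}"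

definition interlaced_le :: "nat \<Rightarrow> nat \<Rightarrow> ((nat \<Rightarrow> nat) \<times> (nat \<Rightarrow> nat)) set" where
  "interlaced_le x y = {(a, b) \<in> interlaced. (\<forall>k\<ge>x. a k = 0) \<and> (\<forall>k\<ge>y. b k = 0)}"

definition weight :: "(nat \<Rightarrow> nat) \<times> (nat \<Rightarrow> nat) \<Rightarrow> nat" where
  "weight = (\<lambda>(a, b). sum a {k. a k \<noteq> 0} + sum b {k. b k \<noteq> 0})"

lemma sum_support_eq:
  fixes a :: "nat \<Rightarrow> nat"
  assumes "\<forall>k\<ge>N. a k = 0"
  shows "sum a {k. a k \<noteq> 0} = sum a {..<N}"
proof (rule sum.mono_neutral_left)
  show "{k. a k \<noteq> 0} \<subseteq> {..<N}" using assms by (auto simp: not_less[symmetric])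
qed auto

lemma weight_eq:
  assumes "\<forall>k\<ge>x. a k = 0" "\<forall>k\<ge>y. b k = 0"
  shows "weight (a, b) = sum a {..<x} + sum b {..<y}"
  unfolding weight_def case_prod_conv sum_support_eq[OF assms(1)] sum_support_eq[OF assms(2)] ..

text \<open>If \<open>a i\<close> is nonzero, the \<open>i + 1\<close> entries up to position
  \<open>i\<close> are all at least 1.\<close>

lemma antimono_support:
  fixes a :: "nat \<Rightarrow> nat"
  assumes "antimono a" "\<forall>k\<ge>N. a k = 0" "a i \<noteq> 0"
  shows "i < sum a {..<N}"
proof -
  have iN: "i < N" using assms(2,3) by (meson not_less)
  have "Suc i = (\<Sum>k<Suc i. 1)" by simp
  also have "\<dots> \<le> sum a {..<Suc i}"
  proof (rule sum_mono)
    fix k assume "k \<in> {..<Suc i}"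
    then have "a i \<le> a k" by (intro antimonoD[OF assms(1)]) simp
    then show "1 \<le> a k" using assms(3) by linarith
  qed
  also have "\<dots> \<le> sum a {..<N}" by (rule sum_mono2) (use iN in auto)
  finally show ?thesis by simp
qed

text \<open>A nonzero entry at position \<open>i\<close> forces weight above \<open>i\<close>. Hence
  growing boxes exhaust all pairs, and coefficients of \<open>box_gf\<close> stabilise.\<close>

lemma interlaced_weight_le:
  assumes "p \<in> interlaced" "weight p \<le> x" "weight p \<le> y"
  shows "p \<in> interlaced_le x y"
proof -
  obtain a b where p: "p = (a, b)" by (cases p)
  obtain N where a: "\<forall>k\<ge>N. a k = 0" and ab: "\<forall>k. b k \<le> a k" "antimono a" "antimono b"
    using assms(1) by (auto simp: interlaced_def p)
  then have b: "\<forall>k\<ge>N. b k = 0" by (metis le_zero_eq)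
  have w: "weight p = sum a {..<N} + sum b {..<N}"
    unfolding p by (rule weight_eq[OF a b])
  have "\<forall>k\<ge>x. a k = 0" "\<forall>k\<ge>y. b k = 0"
    using antimono_support[OF ab(2) a] antimono_support[OF ab(3) b] w assms(2,3)
    by (metis add.commute le_trans not_le trans_less_add1)+
  then show ?thesis using assms(1) by (simp add: interlaced_le_def p)
qed

lemma finite_interlaced_weight: "finite {p \<in> interlaced. weight p = n}"
proof -
  let ?F = "{f. \<forall>k. (k \<in> {..<n} \<longrightarrow> f k \<in> {..n}) \<and> (k \<notin> {..<n} \<longrightarrow> f k = 0)} :: (nat \<Rightarrow> nat) set"
  have "finite ?F" by (rule finite_set_of_finite_funs) auto
  moreover have "{p \<in> interlaced. weight p = n} \<subseteq> ?F \<times> ?F"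
  proof
    fix p assume "p \<in> {p \<in> interlaced. weight p = n}"
    then obtain a b where p: "p = (a, b)" and ab: "(a, b) \<in> interlaced" and n: "weight (a, b) = n"
      by (cases p) auto
    from interlaced_weight_le[OF ab] have *: "\<forall>k\<ge>n. a k = 0" "\<forall>k\<ge>n. b k = 0"
      unfolding n by (simp_all add: interlaced_le_def)
    have "sum a {..<n} \<le> n" "sum b {..<n} \<le> n"
      using weight_eq[OF *] unfolding n by linarith+
    moreover have "f k \<le> sum f {..<n}" if "k < n" for f :: "nat \<Rightarrow> nat" and k
      using that by (intro member_le_sum) auto
    ultimately have "a k \<le> n" "b k \<le> n" if "k < n" for k
      using that le_trans by blast+
    then show "p \<in> ?F \<times> ?F" using * by (auto simp: p not_less)
  qed
  ultimately show ?thesis by (meson finite_SigmaI finite_subset)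
qed

lemma finite_interlaced_le_weight: "finite {p \<in> interlaced_le x y. weight p = n}"
  by (rule finite_subset[OF _ finite_interlaced_weight[of n]]) (auto simp: interlaced_le_def)

section \<open>Generating functions of boxes and their recurrence\<close>

definition box_gf :: "nat \<Rightarrow> nat \<Rightarrow> rat fps" where
  "box_gf x y = genfun weight (interlaced_le x y)"

lemma box_gf_nth_eq:
  assumes "n \<le> x" "n \<le> y"
  shows "fps_nth (box_gf x y) n = fps_nth (genfun weight interlaced) n"
proof -
  have "{p \<in> interlaced_le x y. weight p = n} = {p \<in> interlaced. weight p = n}"
    using interlaced_weight_le assms by (auto simp: interlaced_le_def)
  then show ?thesis by (simp add: box_gf_def genfun_def)
qed

lemma box_gf_0_0: "box_gf 0 0 = 1"
proof (rule fps_ext)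
  fix n
  have "interlaced_le 0 0 = {(\<lambda>_. 0, \<lambda>_. 0)}"
    by (auto simp: interlaced_le_def interlaced_def antimono_def fun_eq_iff)
  then have "{p \<in> interlaced_le 0 0. weight p = n} = (if n = 0 then {(\<lambda>_. 0, \<lambda>_. 0)} else {})"
    by (auto simp: weight_def)
  then show "fps_nth (box_gf 0 0) n = fps_nth 1 n"
    by (simp add: box_gf_def genfun_def)
qed

text \<open>The extra entry satisfies \<open>b x \<le> a x = 0\<close>. This closes the recurrence
  on the side \<open>x = y\<close>.\<close>

lemma box_gf_below_diagonal: "box_gf x (Suc x) = box_gf x x"
proof -
  have "interlaced_le x (Suc x) = interlaced_le x x"
    unfolding interlaced_le_def interlaced_def
    by (safe; metis Suc_leD le_zero_eq)
  then show ?thesis by (simp add: box_gf_def)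
qed

text \<open>The extra entry satisfies \<open>a (y + 4) \<le> b y = 0\<close>. This closes the
  recurrence on the side \<open>x = y + 4\<close>.\<close>

lemma box_gf_above_diagonal: "box_gf (y + 5) y = box_gf (y + 4) y"
proof -
  have "a k = 0" if ab: "(a, b) \<in> interlaced" "\<forall>k\<ge>y. b k = 0" and "k \<ge> y + 4" for a b k
  proof -
    have "a (k - 4 + 4) \<le> b (k - 4)" using ab(1) unfolding interlaced_def by blast
    moreover have "b (k - 4) = 0" using ab(2) that by simp
    ultimately show ?thesis using that by simp
  qed
  then have "interlaced_le (y + 5) y = interlaced_le (y + 4) y"
    unfolding interlaced_le_def by fastforce
  then show ?thesis by (simp add: box_gf_def)
qed

definition raise :: "nat \<Rightarrow> nat \<Rightarrow> (nat \<Rightarrow> nat) \<times> (nat \<Rightarrow> nat) \<Rightarrow> (nat \<Rightarrow> nat) \<times> (nat \<Rightarrow> nat)" where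
  "raise x y = (\<lambda>(a, b). (\<lambda>k. if k < x then a k + 1 else a k, \<lambda>k. if k < y then b k + 1 else b k))"

lemma inj_raise: "inj (raise x y)"
proof (rule injI)
  fix p p' assume eq: "raise x y p = raise x y p'"
  obtain a b a' b' where p: "p = (a, b)" "p' = (a', b')" by (metis surj_pair)
  have "a k = a' k" "b k = b' k" for k
    using fun_cong[of _ _ k, OF arg_cong[OF eq, of fst]] fun_cong[of _ _ k, OF arg_cong[OF eq, of snd]]
    by (auto simp: p raise_def split: if_splits)
  then show "p = p'" by (auto simp: p)
qed

text \<open>By the bounds on \<open>x\<close>, whenever \<open>b k\<close> is raised so is
  \<open>a k\<close>, and whenever \<open>a (k + 4)\<close> is raised so is \<open>b k\<close>; thus
  both interlacing inequalities survive.\<close>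

lemma raise_in_interlaced_le:
  assumes "y \<le> x" "x \<le> y + 4" "p \<in> interlaced_le x y"
  shows "raise x y p \<in> interlaced_le x y"
proof -
  obtain a b where p: "p = (a, b)" by (cases p)
  from assms(3) have *: "antimono a" "antimono b" "\<And>k. b k \<le> a k" "\<And>k. a (k + 4) \<le> b k"
     "\<forall>k\<ge>x. a k = 0" "\<forall>k\<ge>y. b k = 0"
    unfolding p interlaced_le_def interlaced_def by auto
  have "antimono (\<lambda>k. if k < x then a k + 1 else a k)" "antimono (\<lambda>k. if k < y then b k + 1 else b k)"
    using *(1,2,5,6) by (auto simp: antimono_def le_SucI)
  moreover have "(if k < y then b k + 1 else b k) \<le> (if k < x then a k + 1 else a k)"
    "(if k + 4 < x then a (k + 4) + 1 else a (k + 4)) \<le> (if k < y then b k + 1 else b k)" for k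
    using *(3,4)[of k] assms(1,2) by auto
  ultimately show ?thesis
    using *(5,6) unfolding p raise_def interlaced_le_def interlaced_def by (auto intro!: exI[of _ x])
qed

lemma weight_raise:
  assumes "p \<in> interlaced_le x y"
  shows "weight (raise x y p) = weight p + (x + y)"
proof -
  obtain a b where p: "p = (a, b)" by (cases p)
  from assms have *: "\<forall>k\<ge>x. a k = 0" "\<forall>k\<ge>y. b k = 0"
    unfolding p interlaced_le_def by auto
  let ?a = "\<lambda>k. if k < x then a k + 1 else a k" and ?b = "\<lambda>k. if k < y then b k + 1 else b k"
  have "weight (raise x y p) = sum ?a {..<x} + sum ?b {..<y}"
    unfolding p raise_def case_prod_conv by (rule weight_eq) (use * in auto)
  also have "\<dots> = (\<Sum>k<x. a k + 1) + (\<Sum>k<y. b k + 1)" by simp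
  also have "\<dots> = weight p + (x + y)"
    unfolding p by (simp add: weight_eq[OF *] sum.distrib del: add_Suc_right)
  finally show ?thesis .
qed

lemma in_raise_image:
  assumes "y \<le> x" "x \<le> y + 4" "(a, b) \<in> interlaced_le x y"
    and pos: "\<And>k. k < x \<Longrightarrow> a k > 0" "\<And>k. k < y \<Longrightarrow> b k > 0"
  shows "(a, b) \<in> raise x y ` interlaced_le x y"
proof -
  from assms(3) have *: "antimono a" "antimono b" "\<And>k. b k \<le> a k" "\<And>k. a (k + 4) \<le> b k"
     "\<forall>k\<ge>x. a k = 0" "\<forall>k\<ge>y. b k = 0"
    unfolding interlaced_le_def interlaced_def by auto
  have "antimono (\<lambda>k. a k - 1)" "antimono (\<lambda>k. b k - 1)"
    using *(1,2) by (auto simp: antimono_def diff_le_mono)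
  \<comment> \<open>Truncated subtraction is monotone and fixes the zeros outside the box.\<close>
  then have "(\<lambda>k. a k - 1, \<lambda>k. b k - 1) \<in> interlaced_le x y"
    using * unfolding interlaced_le_def interlaced_def by (auto simp: diff_le_mono intro!: exI[of _ x])
  moreover have "raise x y (\<lambda>k. a k - 1, \<lambda>k. b k - 1) = (a, b)"
    using pos *(5,6) by (auto simp: raise_def fun_eq_iff)
  ultimately show ?thesis by (metis imageI)
qed

lemma antimono_pos:
  fixes a :: "nat \<Rightarrow> nat"
  assumes "antimono a" "a x \<noteq> 0" "k \<le> x"
  shows "a k > 0"
  using antimonoD[OF assms(1,3)] assms(2) by simp

lemma vanishes_from:
  fixes a :: "nat \<Rightarrow> nat"
  assumes "\<forall>k\<ge>Suc x. a k = 0" "a x = 0" "x \<le> k"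
  shows "a k = 0"
  using assms by (metis Suc_leI le_eq_less_or_eq)

lemma interlaced_le_mono:
  assumes "p \<in> interlaced_le x y" "x \<le> x'" "y \<le> y'"
  shows "p \<in> interlaced_le x' y'"
  using assms by (auto simp: interlaced_le_def)

text \<open>Either all entries inside the box are positive, and one can be subtracted from each of them,
  or one of the two last entries vanishes.\<close>

lemma box_gf_rec:
  assumes "y \<le> x" "x \<le> y + 4"
  shows "(1 - fps_X ^ (x + y + 2)) * box_gf (Suc x) (Suc y) = box_gf x (Suc y) + box_gf (Suc x) y - box_gf x y"
proof -
  let ?R = "raise (Suc x) (Suc y) ` interlaced_le (Suc x) (Suc y)"
  let ?Z = "interlaced_le x (Suc y) \<union> interlaced_le (Suc x) y"
  have "interlaced_le (Suc x) (Suc y) = ?R \<union> ?Z"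
  proof (intro equalityI subsetI)
    fix p assume p: "p \<in> interlaced_le (Suc x) (Suc y)"
    obtain a b where ab: "p = (a, b)" by (cases p)
    show "p \<in> ?R \<union> ?Z"
    proof (cases "a x = 0 \<or> b y = 0")
      case True
      then have "p \<in> interlaced_le x (Suc y) \<or> p \<in> interlaced_le (Suc x) y"
        using p vanishes_from[of x a] vanishes_from[of y b] unfolding ab interlaced_le_def by blast
      then show ?thesis by blast
    next
      case False
      have "antimono a" "antimono b" using p by (auto simp: ab interlaced_le_def interlaced_def)
      then have "(a, b) \<in> ?R"
        using p assms False unfolding ab
        by (intro in_raise_image) (auto intro: antimono_pos)
      then show ?thesis by (simp add: ab)
    qed
  next
    fix p assume "p \<in> ?R \<union> ?Z"
    then show "p \<in> interlaced_le (Suc x) (Suc y)"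
      using raise_in_interlaced_le[of "Suc y" "Suc x"] assms
      by (auto intro: interlaced_le_mono)
  qed
  \<comment> \<open>Raised pairs are positive at positions \<open>x\<close> and \<open>y\<close>,
    whereas members of \<open>?Z\<close> vanish at one of them.\<close>
  moreover have "?R \<inter> ?Z = {}"
    by (auto simp: raise_def interlaced_le_def split: if_splits)
  moreover have "interlaced_le x (Suc y) \<inter> interlaced_le (Suc x) y = interlaced_le x y"
    unfolding interlaced_le_def by auto
  moreover have fin: "finite {p \<in> ?R. weight p = n}" "finite {p \<in> ?Z. weight p = n}" for n
    by (rule finite_subset[OF _ finite_interlaced_le_weight[of "Suc x" "Suc y" n]];
        use calculation(1) in blast)+
  ultimately have "box_gf (Suc x) (Suc y) = genfun weight ?R + genfun weight ?Z"
    and "genfun weight ?Z + box_gf x y = box_gf x (Suc y) + box_gf (Suc x) y"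
    using genfun_Un_Int[OF fin]
      genfun_Un_Int[OF finite_interlaced_le_weight finite_interlaced_le_weight, of x "Suc y" "Suc x" y]
    by (simp_all add: box_gf_def genfun_def fps_zero_def[symmetric])
  moreover have "genfun weight ?R = fps_X ^ (x + y + 2) * box_gf (Suc x) (Suc y)"
    unfolding box_gf_def
    by (subst genfun_image_shift[where k = "x + y + 2"])
      (auto simp: weight_raise intro: inj_on_subset[OF inj_raise])
  ultimately show ?thesis
    unfolding left_diff_distrib mult_1_left by (metis add_diff_cancel_left' add_diff_cancel_right')
qed

text \<open>In the row \<open>y = 0\<close> only the last entry of \<open>a\<close> can vanish, so
  no inclusion-exclusion arises. The bound on \<open>x\<close> lets \<open>raise\<close> preserve
  the box \<open>(Suc x, 0)\<close>.\<close>

lemma box_gf_rec_0: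
  assumes "x < 4"
  shows "(1 - fps_X ^ Suc x) * box_gf (Suc x) 0 = box_gf x 0"
proof -
  let ?R = "raise (Suc x) 0 ` interlaced_le (Suc x) 0"
  have "interlaced_le (Suc x) 0 = ?R \<union> interlaced_le x 0"
  proof (intro equalityI subsetI)
    fix p assume p: "p \<in> interlaced_le (Suc x) 0"
    obtain a b where ab: "p = (a, b)" by (cases p)
    show "p \<in> ?R \<union> interlaced_le x 0"
    proof (cases "a x = 0")
      case True
      then have "p \<in> interlaced_le x 0"
        using p unfolding ab interlaced_le_def by (auto intro: vanishes_from)
      then show ?thesis by simp
    next
      case False
      have "antimono a" using p by (auto simp: ab interlaced_le_def interlaced_def)
      then have "(a, b) \<in> ?R"
        using p assms False unfolding ab
        by (intro in_raise_image) (auto intro: antimono_pos)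
      then show ?thesis by (simp add: ab)
    qed
  next
    fix p assume "p \<in> ?R \<union> interlaced_le x 0"
    then show "p \<in> interlaced_le (Suc x) 0"
      using raise_in_interlaced_le[of 0 "Suc x"] assms
      by (auto intro: interlaced_le_mono)
  qed
  moreover have "?R \<inter> interlaced_le x 0 = {}"
    by (auto simp: raise_def interlaced_le_def split: if_splits)
  moreover have fin: "finite {p \<in> ?R. weight p = n}" for n
    by (rule finite_subset[OF _ finite_interlaced_le_weight[of "Suc x" 0 n]])
      (use calculation(1) in blast)
  ultimately have "box_gf (Suc x) 0 = genfun weight ?R + box_gf x 0"
    using genfun_Un_Int[OF fin finite_interlaced_le_weight, of x 0]
    by (simp add: box_gf_def genfun_def fps_zero_def[symmetric])
  moreover have "genfun weight ?R = fps_X ^ Suc x * box_gf (Suc x) 0"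
    unfolding box_gf_def
    by (subst genfun_image_shift[where k = "Suc x"])
      (auto simp: weight_raise intro: inj_on_subset[OF inj_raise])
  ultimately show ?thesis by (simp add: algebra_simps)
qed

subsection \<open>Cylindric partitions as interlaced pairs\<close>

lemma partition_of_fun:
  assumes "antimono g" "\<forall>k\<ge>N. g k = 0"
  obtains p where "is_partition p" "part p = g"
proof -
  \<comment> \<open>By monotonicity the support of \<open>g\<close> is exactly
    \<open>{..<m}\<close>, so the values below \<open>m\<close> are the positive parts.\<close>
  define m where "m = (LEAST n. g n = 0)"
  have m: "g m = 0" unfolding m_def by (rule LeastI[of _ N]) (simp add: assms(2))
  have pos: "g k > 0" if "k < m" for k
    using not_less_Least[of k "\<lambda>n. g n = 0"] that unfolding m_def by auto
  have zero: "g k = 0" if "k \<ge> m" for k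
    using antimonoD[OF assms(1) that] m by simp
  have "is_partition (map g [0..<m])"
    unfolding is_partition_def sorted_wrt_map
    using pos antimonoD[OF assms(1)] by (auto simp: sorted_wrt_iff_nth_less)
  moreover have "part (map g [0..<m]) = g"
    using zero by (auto simp: part_def fun_eq_iff)
  ultimately show ?thesis by (rule that)
qed

lemma antimono_part:
  assumes "is_partition p"
  shows "antimono (part p)"
proof (rule antimonoI)
  fix i j :: nat assume "i \<le> j"
  then show "part p j \<le> part p i"
    using assms by (cases "i = j") (auto simp: part_def is_partition_def sorted_wrt_iff_nth_less)
qed

text \<open>Since listed parts are positive, the length can be read off from where
  \<open>part\<close> is nonzero.\<close>

lemma part_inject:
  assumes "is_partition p" "is_partition p'" "part p = part p'"
  shows "p = p'"
proof -
  have len: "k < length p \<longleftrightarrow> part p k \<noteq> 0" if "is_partition p" for p k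
    using that by (auto simp: part_def is_partition_def)
  have "k < length p \<longleftrightarrow> k < length p'" for k
    by (simp add: len assms)
  then have "length p = length p'" by (metis less_irrefl linorder_cases)
  then show ?thesis
  proof (rule nth_equalityI)
    fix i assume "i < length p"
    then show "p ! i = p' ! i"
      using fun_cong[OF assms(3), of i] \<open>length p = length p'\<close> by (simp add: part_def)
  qed
qed

lemma sum_list_part:
  assumes "length p \<le> N"
  shows "sum_list p = (\<Sum>j<N. part p j)"
proof -
  have "sum_list p = (\<Sum>j<length p. part p j)"
    by (simp add: sum_list_sum_nth part_def atLeast0LessThan)
  also have "\<dots> = (\<Sum>j<N. part p j)"
    by (rule sum.mono_neutral_left) (use assms in \<open>auto simp: part_def\<close>)
  finally show ?thesis .
qed

text \<open>Passing from component 3 back to component 0 advances the part index by 2, so each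
  parity of part indices gives one chain that runs cyclically through the components.\<close>

definition columns :: "nat list list \<Rightarrow> (nat \<Rightarrow> nat) \<times> (nat \<Rightarrow> nat)" where
  "columns L = (\<lambda>k. part (L ! (k mod 4)) (2 * (k div 4)), \<lambda>k. part (L ! (k mod 4)) (2 * (k div 4) + 1))"

lemma cylindric_2000_iff:
  "L \<in> cylindric_partitions [2, 0, 0, 0] \<longleftrightarrow>
     length L = 4 \<and> (\<forall>i<4. is_partition (L ! i)) \<and>
     (\<forall>i<3. \<forall>j. part (L ! Suc i) j \<le> part (L ! i) j) \<and> (\<forall>j. part (L ! 0) (j + 2) \<le> part (L ! 3) j)"
  by (auto simp: cylindric_partitions_def is_profile_def all_set_conv_all_nth less_Suc_eq eval_nat_numeral)

lemma antimono_columns: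
  assumes L: "L \<in> cylindric_partitions [2, 0, 0, 0]"
  shows "antimono (\<lambda>k. part (L ! (k mod 4)) (2 * (k div 4) + e))"
  unfolding antimono_iff_le_Suc
proof
  fix k
  show "part (L ! (Suc k mod 4)) (2 * (Suc k div 4) + e) \<le> part (L ! (k mod 4)) (2 * (k div 4) + e)"
  proof (cases "k mod 4 = 3")
    case True
    then have "Suc k mod 4 = 0" "Suc k div 4 = Suc (k div 4)" by presburger+
    with L True show ?thesis
      unfolding cylindric_2000_iff by (simp add: add.commute add.left_commute)
  next
    case False
    then have "Suc k mod 4 = Suc (k mod 4)" "Suc k div 4 = k div 4" "k mod 4 < 3" by presburger+
    with L show ?thesis
      unfolding cylindric_2000_iff by simp
  qed
qed

text \<open>With \<open>k = 4 * j + i\<close>, the entries \<open>a k\<close>, \<open>b k\<close>,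
  \<open>a (k + 4)\<close> are the parts \<open>2 * j\<close>, \<open>2 * j + 1\<close>,
  \<open>2 * j + 2\<close> of component \<open>i\<close>.\<close>

lemma columns_interlaced:
  assumes L: "L \<in> cylindric_partitions [2, 0, 0, 0]"
  shows "columns L \<in> interlaced"
proof -
  have part: "antimono (part (L ! (k mod 4)))" for k
    using L unfolding cylindric_2000_iff by (auto intro: antimono_part)
  define N where "N = length (L ! 0)"
  have "part (L ! (k mod 4)) (2 * (k div 4)) = 0" if "k \<ge> 4 * N" for k
  proof -
    have "part (L ! ((4 * N) mod 4)) (2 * ((4 * N) div 4)) = 0" by (simp add: part_def N_def)
    then show ?thesis
      using antimonoD[OF antimono_columns[OF L, of 0] that] by simp
  qed
  then show ?thesis
    using antimono_columns[OF L, of 0] antimono_columns[OF L, of 1]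
    unfolding columns_def interlaced_def by (auto intro: antimonoD[OF part])
qed

lemma columns_fst: "i < 4 \<Longrightarrow> fst (columns L) (4 * j + i) = part (L ! i) (2 * j)"
  and columns_snd: "i < 4 \<Longrightarrow> snd (columns L) (4 * j + i) = part (L ! i) (2 * j + 1)"
  by (simp_all add: columns_def)

lemma weight_columns:
  assumes L: "L \<in> cylindric_partitions [2, 0, 0, 0]"
  shows "weight (columns L) = cp_size L"
proof -
  obtain N where a: "\<forall>k\<ge>N. fst (columns L) k = 0" and ab: "\<forall>k. snd (columns L) k \<le> fst (columns L) k"
    using columns_interlaced[OF L] by (auto simp: interlaced_def split: prod.splits)
  \<comment> \<open>Large enough that neither the sums over parts below \<open>2 * M\<close> nor
    those over columns below \<open>4 * M\<close> lose a nonzero term.\<close>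
  define M where "M = N + length (L ! 0) + length (L ! 1) + length (L ! 2) + length (L ! 3)"
  have len: "length L = 4" using L by (simp add: cylindric_2000_iff)
  then have "L = [L ! 0, L ! 1, L ! 2, L ! 3]"
    by (intro nth_equalityI) (auto simp: less_Suc_eq eval_nat_numeral)
  then have "cp_size L = cp_size [L ! 0, L ! 1, L ! 2, L ! 3]" by (rule arg_cong)
  also have "\<dots> = sum_list (L ! 0) + sum_list (L ! 1) + sum_list (L ! 2) + sum_list (L ! 3)"
    by (simp add: cp_size_def)
  also have "\<dots> = (\<Sum>j<2*M. part (L ! 0) j) + (\<Sum>j<2*M. part (L ! 1) j)
      + (\<Sum>j<2*M. part (L ! 2) j) + (\<Sum>j<2*M. part (L ! 3) j)"
    by (simp add: sum_list_part[of _ "2 * M"] M_def)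
  also have "\<dots> = (\<Sum>k<4*M. fst (columns L) k) + (\<Sum>k<4*M. snd (columns L) k)"
  proof (induction M)
    case (Suc M)
    have "4 * Suc M = Suc (Suc (Suc (Suc (4 * M))))" "2 * Suc M = Suc (Suc (2 * M))" by simp_all
    then have "(\<Sum>k<4 * Suc M. f k) = (\<Sum>k<4 * M. f k) + f (4 * M + 0) + f (4 * M + 1) + f (4 * M + 2) + f (4 * M + 3)"
      "(\<Sum>k<2 * Suc M. f k) = (\<Sum>k<2 * M. f k) + f (2 * M) + f (2 * M + 1)" for f :: "nat \<Rightarrow> nat"
      by (simp_all add: sum.lessThan_Suc eval_nat_numeral)
    then show ?case using Suc by (simp only: columns_fst columns_snd)
  qed simp
  also have "\<dots> = weight (columns L)"
  proof -
    have "\<forall>k\<ge>4*M. fst (columns L) k = 0" using a by (auto simp: M_def)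
    moreover from this have "\<forall>k\<ge>4*M. snd (columns L) k = 0" using ab by (metis le_zero_eq)
    ultimately show ?thesis using weight_eq by (metis prod.collapse)
  qed
  finally show ?thesis ..
qed

lemma inj_columns: "inj_on columns (cylindric_partitions [2, 0, 0, 0])"
proof (rule inj_onI)
  fix L L' assume L: "L \<in> cylindric_partitions [2, 0, 0, 0]" "L' \<in> cylindric_partitions [2, 0, 0, 0]"
    and eq: "columns L = columns L'"
  show "L = L'"
  proof (rule nth_equalityI)
    show "length L = length L'" using L by (simp add: cylindric_2000_iff)
    fix i assume "i < length L"
    then have i: "i < 4" using L by (simp add: cylindric_2000_iff)
    have "part (L ! i) j = part (L' ! i) j" for j
      using columns_fst[OF i, of L "j div 2"] columns_fst[OF i, of L' "j div 2"]
        columns_snd[OF i, of L "j div 2"] columns_snd[OF i, of L' "j div 2"] eq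
      by (cases "even j") auto
    then show "L ! i = L' ! i"
      using L i by (intro part_inject) (auto simp: cylindric_2000_iff)
  qed
qed

lemma columns_surj:
  assumes "p \<in> interlaced"
  shows "p \<in> columns ` cylindric_partitions [2, 0, 0, 0]"
proof -
  obtain a b where p: "p = (a, b)" by (cases p)
  obtain N where ab: "antimono a" "antimono b" "\<And>k. b k \<le> a k" "\<And>k. a (k + 4) \<le> b k"
    and a0: "\<And>k. k \<ge> N \<Longrightarrow> a k = 0"
    using assms by (auto simp: interlaced_def p)
  have b0: "b k = 0" if "k \<ge> N" for k using ab(3)[of k] a0[OF that] by simp
  \<comment> \<open>The inverse reading: parity of the part index selects the sequence, and
    \<open>4 * (j div 2) + i\<close> is the place within it.\<close>
  define g where "g i j = (if even j then a else b) (4 * (j div 2) + i)" for i j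
  have "antimono (g i)" for i
    unfolding antimono_iff_le_Suc
  proof
    fix j
    show "g i (Suc j) \<le> g i j"
      using ab(3)[of "4 * (j div 2) + i"] ab(4)[of "4 * (j div 2) + i"]
      by (cases "even j") (auto simp: g_def add.commute add.left_commute)
  qed
  moreover have "\<forall>j\<ge>2 * N. g i j = 0" for i
    using a0 b0 by (auto simp: g_def)
  ultimately have "\<exists>l. is_partition l \<and> part l = g i" for i
    using partition_of_fun[of "g i"] by metis
  then obtain l where l: "\<And>i. is_partition (l i)" "\<And>i. part (l i) = g i" by metis
  let ?L = "map l [0..<4]"
  have "g (Suc i) j \<le> g i j" for i j
    using antimonoD[OF ab(1), of "4 * (j div 2) + i" "4 * (j div 2) + Suc i"]
      antimonoD[OF ab(2), of "4 * (j div 2) + i" "4 * (j div 2) + Suc i"]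
    by (simp add: g_def)
  moreover have "g 0 (j + 2) \<le> g 3 j" for j
    using antimonoD[OF ab(1), of "4 * (j div 2) + 3" "4 * (j div 2) + 4"]
      antimonoD[OF ab(2), of "4 * (j div 2) + 3" "4 * (j div 2) + 4"]
    by (simp add: g_def add.commute)
  ultimately have L: "?L \<in> cylindric_partitions [2, 0, 0, 0]"
    unfolding cylindric_2000_iff by (simp add: l)
  have "columns ?L = (a, b)"
    by (simp add: columns_def l g_def)
  then show ?thesis using L p by (metis imageI)
qed

lemma bij_columns: "bij_betw columns (cylindric_partitions [2, 0, 0, 0]) interlaced"
  unfolding bij_betw_def
  using inj_columns columns_interlaced columns_surj by blast

lemma finite_cylindric_weight: "finite {L \<in> cylindric_partitions [2, 0, 0, 0]. cp_size L = n}"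
proof -
  have "bij_betw columns {L \<in> cylindric_partitions [2, 0, 0, 0]. cp_size L = n} {p \<in> interlaced. weight p = n}"
    by (rule bij_betw_Collect[OF bij_columns]) (simp add: weight_columns)
  then show ?thesis using finite_interlaced_weight bij_betw_finite by blast
qed

subsection \<open>The recurrence along the diagonals\<close>

definition qfact :: "nat \<Rightarrow> rat fps" where
  "qfact n = qpoch fps_X fps_X n"

text \<open>\<open>diag1\<close>, \<open>diag2\<close>, \<open>diag3\<close> belong to the boxes with \<open>x - y = 1, 2, 3\<close>; the value \<open>0\<close> of
  \<open>diag3 0\<close> stands for the box with \<open>y = -1\<close>.\<close>

definition diag1 :: "nat \<Rightarrow> rat fps" where
  "diag1 m = qfact (2 * m + 1) * box_gf (m + 1) m"

definition diag2 :: "nat \<Rightarrow> rat fps" where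
  "diag2 m = qfact (2 * m + 2) * box_gf (m + 2) m"

definition diag3 :: "nat \<Rightarrow> rat fps" where
  "diag3 m = (if m = 0 then 0 else qfact (2 * m + 1) * box_gf (m + 2) (m - 1))"

lemma qfact_Suc: "qfact (Suc n) = qfact n * (1 - fps_X ^ Suc n)"
  by (simp add: qfact_def qpoch_Suc)

text \<open>In the recurrence, \<open>box_gf m (Suc m)\<close> cancels against
  \<open>box_gf m m\<close>. This eliminates the diagonal \<open>x = y\<close>.\<close>

lemma box_gf_diagonal: "(1 - fps_X ^ (2 * m + 2)) * box_gf (Suc m) (Suc m) = box_gf (Suc m) m"
  using box_gf_rec[of m m] by (simp add: box_gf_below_diagonal mult_2)

text \<open>The same cancellation at the other border eliminates the diagonal
  \<open>x - y = 4\<close>; for \<open>m = 0\<close> the row \<open>y = 0\<close> supplies the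
  claim.\<close>

lemma box_gf_far_diagonal: "(1 - fps_X ^ (2 * m + 4)) * box_gf (m + 4) m = box_gf (m + 3) m"
proof (cases m)
  case 0
  then show ?thesis using box_gf_rec_0[of 3] by (simp add: eval_nat_numeral)
next
  case (Suc n)
  show ?thesis
    using box_gf_rec[of n "n + 4"] box_gf_above_diagonal[of n] unfolding Suc
    by (simp add: eval_nat_numeral)
qed

lemma diag1_0: "diag1 0 = 1"
  using box_gf_rec_0[of 0] by (simp add: diag1_def qfact_Suc box_gf_0_0) (simp add: qfact_def box_gf_0_0)

lemma diag2_0: "diag2 0 = 1"
  using box_gf_rec_0[of 0] box_gf_rec_0[of 1]
  by (simp add: diag2_def qfact_Suc eval_nat_numeral box_gf_0_0 mult.assoc) (simp add: qfact_def)

text \<open>The recurrence at \<open>(m + 2, m + 1)\<close>. After eliminating the box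
  \<open>(m + 1, m + 1)\<close>, the last two terms are \<open>diag1 m\<close> and
  \<open>(1 - fps_X ^ (2 * m + 2)) * diag1 m\<close>.\<close>

lemma diag1_Suc: "diag1 (Suc m) = diag2 m + fps_X ^ (2 * m + 2) * diag1 m"
proof -
  have 1: "(1 - fps_X ^ (2 * m + 3)) * box_gf (m + 2) (Suc m) = box_gf (Suc m) (Suc m) + box_gf (m + 2) m - box_gf (Suc m) m"
    using box_gf_rec[of m "Suc m"] by (simp add: eval_nat_numeral mult_2)
  have "diag1 (Suc m) = qfact (2 * m + 2) * ((1 - fps_X ^ (2 * m + 3)) * box_gf (m + 2) (Suc m))"
    unfolding diag1_def using qfact_Suc[of "2 * m + 2"] by (simp add: eval_nat_numeral mult_ac)
  also have "\<dots> = diag2 m + qfact (2 * m + 2) * box_gf (Suc m) (Suc m) - qfact (2 * m + 2) * box_gf (Suc m) m"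
    unfolding 1 by (simp add: diag2_def algebra_simps)
  also have "qfact (2 * m + 2) = qfact (2 * m + 1) * (1 - fps_X ^ (2 * m + 2))"
    using qfact_Suc[of "2 * m + 1"] by simp
  also have "\<dots> * box_gf (Suc m) (Suc m) = diag1 m"
    unfolding mult.assoc box_gf_diagonal by (simp add: diag1_def)
  finally show ?thesis by (simp add: diag1_def algebra_simps)
qed

text \<open>The mirror image of \<open>diag1_Suc\<close>, with the diagonal \<open>x - y = 4\<close>
  eliminated; the value \<open>diag3 0 = 0\<close> matches the row \<open>y = 0\<close>.\<close>

lemma diag3_Suc: "diag3 (Suc m) = diag2 m + fps_X ^ (2 * m + 2) * diag3 m"
proof (cases m)
  case 0
  have "(1 - fps_X ^ 3) * box_gf 3 0 = box_gf 2 0" using box_gf_rec_0[of 2] by (simp add: eval_nat_numeral)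
  then show ?thesis
    using qfact_Suc[of 2] by (simp add: diag3_def diag2_def 0 eval_nat_numeral mult.assoc)
next
  case (Suc n)
  have 1: "(1 - fps_X ^ (2 * n + 5)) * box_gf (n + 4) (Suc n) = box_gf (n + 3) (Suc n) + box_gf (n + 4) n - box_gf (n + 3) n"
    using box_gf_rec[of n "n + 3"] by (simp add: eval_nat_numeral mult_2)
  have "diag3 (Suc m) = qfact (2 * n + 4) * ((1 - fps_X ^ (2 * n + 5)) * box_gf (n + 4) (Suc n))"
    unfolding diag3_def Suc using qfact_Suc[of "2 * n + 4"] by (simp add: eval_nat_numeral mult_ac)
  also have "\<dots> = diag2 m + qfact (2 * n + 4) * box_gf (n + 4) n - qfact (2 * n + 4) * box_gf (n + 3) n"
    unfolding 1 by (simp add: diag2_def Suc algebra_simps eval_nat_numeral)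
  also have "qfact (2 * n + 4) = qfact (2 * n + 3) * (1 - fps_X ^ (2 * n + 4))"
    using qfact_Suc[of "2 * n + 3"] by (simp add: eval_nat_numeral)
  also have "\<dots> * box_gf (n + 4) n = diag3 m"
    unfolding mult.assoc box_gf_far_diagonal by (simp add: diag3_def Suc eval_nat_numeral)
  finally show ?thesis by (simp add: diag3_def Suc algebra_simps eval_nat_numeral)
qed

text \<open>All boxes of the recurrence at \<open>(m + 3, m + 1)\<close> lie on the three kept
  diagonals; the factor comes from passing from \<open>qfact (2 * m + 2)\<close> to
  \<open>qfact (2 * m + 3)\<close>.\<close>

lemma diag2_Suc: "diag2 (Suc m) = diag1 (Suc m) + diag3 (Suc m) - (1 - fps_X ^ (2 * m + 3)) * diag2 m"
proof -
  have 1: "(1 - fps_X ^ (2 * m + 4)) * box_gf (m + 3) (Suc m) = box_gf (m + 2) (Suc m) + box_gf (m + 3) m - box_gf (m + 2) m"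
    using box_gf_rec[of m "m + 2"] by (simp add: eval_nat_numeral mult_2)
  have "diag2 (Suc m) = qfact (2 * m + 3) * ((1 - fps_X ^ (2 * m + 4)) * box_gf (m + 3) (Suc m))"
    unfolding diag2_def using qfact_Suc[of "2 * m + 3"] by (simp add: eval_nat_numeral mult_ac)
  also have "\<dots> = diag1 (Suc m) + diag3 (Suc m) - qfact (2 * m + 3) * box_gf (m + 2) m"
    unfolding 1 by (simp add: diag1_def diag3_def algebra_simps eval_nat_numeral)
  also have "qfact (2 * m + 3) = (1 - fps_X ^ (2 * m + 3)) * qfact (2 * m + 2)"
    using qfact_Suc[of "2 * m + 2"] by (simp add: eval_nat_numeral mult_ac)
  finally show ?thesis by (simp add: diag2_def mult.assoc)
qed

text \<open>The recurrence of \<open>qseries\<close> is the adjoint of the recurrences above, so that this pairing does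
  not depend on \<open>m\<close>.\<close>

lemma diag_invariant:
  "diag2 m * qseries m + fps_X ^ (2 * m + 2) * (diag1 m + diag3 m - diag2 m) * qseries (m + 1) = qseries 0"
proof (induction m)
  \<comment> \<open>Here \<open>diag1 0 + diag3 0 - diag2 0 = 0\<close>, so only
    \<open>qseries 0\<close> remains.\<close>
  case 0
  then show ?case by (simp add: diag2_0 diag1_0 diag3_def)
next
  case (Suc m)
  obtain x where x: "fps_X = (x :: rat fps)" by blast
  define t where "t = x ^ (2 * m)"
  have pows: "x ^ (2 * m + 2) = t * x ^ 2" "x ^ (2 * m + 3) = t * x ^ 3"
    "x ^ (2 * m + 4) = t * x ^ 4" "x ^ (2 * Suc m + 2) = t * x ^ 4"
    by (simp_all add: t_def power_add eval_nat_numeral mult_ac)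
  have idx: "Suc m + 1 = m + 2" by simp
  \<comment> \<open>Expanding \<open>qseries m\<close> leaves combinations of
    \<open>qseries (m + 1)\<close> and \<open>qseries (m + 2)\<close>, whose coefficients agree on
    both sides.\<close>
  have "diag2 (Suc m) * qseries (m + 1)
      + t * x ^ 4 * (diag1 (Suc m) + diag3 (Suc m) - diag2 (Suc m)) * qseries (m + 2)
    = diag2 m * qseries m + t * x ^ 2 * (diag1 m + diag3 m - diag2 m) * qseries (m + 1)"
    unfolding diag2_Suc unfolding diag1_Suc diag3_Suc qseries_rec[of m] x pows
    by (simp add: algebra_simps eval_nat_numeral)
  then show ?case
    unfolding Suc[symmetric] x pows idx by simp
qed

theorem theorem5p4:
  fixes q :: "rat fps"
  defines "q \<equiv> fps_X"
  shows "((\<lambda>L. q ^ cp_size L) has_sum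
           ((\<Sum>n. q ^ (n * (n + 1)) * qpoch (- (q ^ 2)) (q ^ 2) n /
                   (qpoch (- (q ^ 3)) (q ^ 2) n * qpoch (q ^ 2) (q ^ 2) n))
             * (qpoch_inf (- (q ^ 3)) (q ^ 2) / qpoch_inf q q)))
         (cylindric_partitions [2, 0, 0, 0])"
proof -
  let ?F = "genfun weight interlaced"
  let ?P = "qpoch_inf fps_X fps_X :: rat fps"
  have product: "?P * ?F = qseries 0"
  proof (rule fps_eq_if_diff_dvd)
    fix K
    have P: "fps_X ^ K dvd ?P - qfact (2 * K + 2)"
      unfolding qfact_def
      by (rule dvd_trans[OF le_imp_power_dvd qpoch_inf_dvd]) simp_all
    \<comment> \<open>The box \<open>(K + 2, K)\<close> contains every pair of weight below
      \<open>K\<close>; it is the box of \<open>diag2 K\<close>, which therefore approximates the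
      product.\<close>
    have F: "fps_X ^ K dvd ?F - box_gf (K + 2) K"
      by (simp add: fps_X_power_dvd_iff box_gf_nth_eq)
    have "fps_X ^ K dvd qseries K - 1"
      by (rule dvd_trans[OF le_imp_power_dvd qseries_minus_1_dvd]) simp
    moreover have "fps_X ^ K dvd (fps_X ^ (2 * K + 2) :: rat fps)" by (rule le_imp_power_dvd) simp
    \<comment> \<open>The invariant at \<open>m = K\<close>: its first term tends to
      \<open>diag2 K\<close>, and its second is killed by the power of \<open>fps_X\<close>.\<close>
    moreover have "diag2 K - qseries 0
      = - diag2 K * (qseries K - 1) - fps_X ^ (2 * K + 2) * ((diag1 K + diag3 K - diag2 K) * qseries (K + 1))"
      unfolding diag_invariant[of K, symmetric] by (simp add: algebra_simps)
    ultimately have "fps_X ^ K dvd diag2 K - qseries 0"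
      by (simp only: dvd_diff dvd_mult dvd_mult2)
    moreover have "fps_X ^ K dvd ?P * ?F - diag2 K"
      unfolding diag2_def by (rule dvd_mult_diff[OF P F])
    ultimately show "fps_X ^ K dvd ?P * ?F - qseries 0" using dvd_diff_trans by blast
  qed
  have P0: "fps_nth ?P 0 = 1" by (rule qpoch_inf_nth_0) simp_all
  then have "?P * inverse ?P = 1" by (intro inverse_mult_eq_1') simp
  then have "?F = (?P * ?F) * inverse ?P" by (simp add: mult_ac)
  also have "\<dots> = qseries 0 * inverse ?P" unfolding product ..
  also have "\<dots> = (\<Sum>n. q ^ (n * (n + 1)) * qpoch (- (q ^ 2)) (q ^ 2) n /
                   (qpoch (- (q ^ 3)) (q ^ 2) n * qpoch (q ^ 2) (q ^ 2) n))
             * (qpoch_inf (- (q ^ 3)) (q ^ 2) / qpoch_inf q q)"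
    unfolding q_def qseries_0[symmetric] using P0
    by (simp add: fps_divide_unit mult.assoc)
  finally have F: "?F = \<dots>" .
  have "genfun cp_size (cylindric_partitions [2, 0, 0, 0]) = ?F"
    using bij_columns by (rule bij_betw_genfun) (rule weight_columns)
  with genfun_has_sum[OF finite_cylindric_weight] show ?thesis
    unfolding F q_def by (simp only:)
qed

end
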